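(* Let $E$ be a Hilbert space and let $\tau$ be a Hausdorff topology on $E$. Let $\{ T(t) : t \geq 0 \}$ be a one-parameter $\tau$-continuous semigroup of nonexpansive mappings on a bounded closed convex subset $C$ of $E$. Fix $\alpha, \beta > 0$ with $\alpha / \beta \notin \mathbb{Q}$. Let $u \in C$ and define a sequence $\{ x_n \}$ in $C$ by $x_1 \in C$ and $$ x_{n+1} = \frac{1-\lambda_n}{2} T(\alpha) x_n + \frac{1-\lambda_n}{2} T(\beta) x_n + \lambda_n u $$ for $n \in \mathbb{N}$, where $\{ \lambda_n \}$ is a sequence in $[0,1]$ satisfying $$ \lim_{n \rightarrow \infty} \lambda_n = 0, \quad \sum_{n=1}^\infty \lambda_n = \infty, \quad\text{and}\quad \sum_{n=1}^\infty | \lambda_{n+1} - \lambda_n | < \infty . $$ Then $\{ x_n \}$ converges strongly to a common fixed point of $\{ T(t) : t \geq 0 \}$.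
   Context: $\mathbb{N}$ is the set of positive integers and $\mathbb{Q}$ the set of rational numbers. Let $C$ be a subset of a Banach space $E$ and let $\tau$ be a Hausdorff topology on $E$ (not necessarily the norm topology). A family $\{T(t) : t \geq 0\}$ of mappings from $C$ into $C$ is called a one-parameter $\tau$-continuous semigroup of nonexpansive mappings on $C$ if: (sg 1) $T(s+t) = T(s) \circ T(t)$ for all $s, t \geq 0$; (sg 2) for each $x \in C$, the mapping $t \mapsto T(t)x$ from $[0,\infty)$ into $C$ is continuous with respect to $\tau$; (sg 3) for each $t \geq 0$, $T(t)$ is nonexpansive, i.e., $\|T(t)x - T(t)y\| \leq \|x-y\|$ for all $x,y \in C$. (It is not required that $T(0)$ be the identity mapping.) A common fixed point of $\{T(t) : t \geq 0\}$ is a point $z \in C$ with $T(t)z = z$ for all $t \geq 0$. Strong convergence is convergence in norm. *)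

theory Defs
  imports "HOL-Analysis.Analysis"
begin

(* The topology tau is passed as an explicit object because it need not be the norm topology
   carried by the type.  T is a total function, but it is constrained only at times t >= 0 and
   on points of C.  T 0 is not required to be the identity on C. *)
definition nonexpansive_semigroup ::
  "('a::banach) topology \<Rightarrow> 'a set \<Rightarrow> (real \<Rightarrow> 'a \<Rightarrow> 'a) \<Rightarrow> bool" where
  "nonexpansive_semigroup \<tau> C T \<longleftrightarrow>
     (\<forall>t\<ge>0. T t ` C \<subseteq> C) \<and>
     (\<forall>s\<ge>0. \<forall>t\<ge>0. \<forall>x\<in>C. T (s + t) x = T s (T t x)) \<and>
     (\<forall>x\<in>C. continuous_map (top_of_set {0..}) (subtopology \<tau> C) (\<lambda>t. T t x)) \<and>
     (\<forall>t\<ge>0. \<forall>x\<in>C. \<forall>y\<in>C. norm (T t x - T t y) \<le> norm (x - y))"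

definition common_fixed_point :: "'a set \<Rightarrow> (real \<Rightarrow> 'a \<Rightarrow> 'a) \<Rightarrow> 'a \<Rightarrow> bool" where
  "common_fixed_point C T z \<longleftrightarrow> z \<in> C \<and> (\<forall>t\<ge>0. T t z = z)"

end

theory Submission
  imports Defs
begin

text \<open>The sequence is the Halpern iteration of the nonexpansive map $S = (T(\alpha) + T(\beta))/2$,
  so it converges to a fixed point of $S$. The commuting maps $T(\alpha)$ and $T(\beta)$ have a
  common fixed point, hence by strict convexity every fixed point of $S$ is fixed by both. The
  times fixing such a point are dense because $\alpha/\beta$ is irrational, and continuity for a
  Hausdorff topology extends this to all times.\<close>

section \<open>Fixed points of nonexpansive mappings in a Hilbert space\<close>

text \<open>Strict convexity of the Hilbert norm in quantitative form. The subtracted term in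
  \<open>norm (x - y)\<close> is what forces equality in the two fixed point arguments that use
  it.\<close>

lemma norm_diff_convex_combination_sq:
  fixes q x y :: "'a::real_inner"
  shows "(norm (q - ((1 - t) *\<^sub>R x + t *\<^sub>R y)))\<^sup>2 =
    (1 - t) * (norm (q - x))\<^sup>2 + t * (norm (q - y))\<^sup>2 - t * (1 - t) * (norm (x - y))\<^sup>2"
  unfolding power2_norm_eq_inner
  by (simp add: inner_diff_left inner_diff_right inner_add_left inner_add_right inner_commute
      algebra_simps power2_eq_square)

text \<open>The two sides differ by exactly the square of \<open>norm b\<close>. In the iteration,
  \<open>b\<close> is the anchor term, so the weight \<open>l n\<close> enters linearly and is
  paired with the new iterate.\<close>

lemma norm_add_sq_le:
  fixes a b :: "'a::real_inner"
  shows "(norm (a + b))\<^sup>2 \<le> (norm a)\<^sup>2 + 2 * inner b (a + b)"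
proof -
  have "(norm a)\<^sup>2 + 2 * inner b (a + b) - (norm (a + b))\<^sup>2 = (norm b)\<^sup>2"
    unfolding power2_norm_eq_inner by (simp add: inner_add_left inner_add_right inner_commute)
  then show ?thesis
    by (smt (verit) zero_le_power2)
qed

text \<open>Monotonicity of the operator I - S. It yields both the Cauchy property of the path and
  the comparison of the path with the iterates.\<close>

lemma nonexpansive_complement_monotone:
  fixes S :: "'a::real_inner \<Rightarrow> 'a"
  assumes "1-lipschitz_on C S" "x \<in> C" "y \<in> C"
  shows "0 \<le> inner ((x - S x) - (y - S y)) (x - y)"
proof -
  have "inner (S x - S y) (x - y) \<le> norm (S x - S y) * norm (x - y)"
    by (rule norm_cauchy_schwarz)
  also have "\<dots> \<le> norm (x - y) * norm (x - y)"
    using lipschitz_onD[OF assms] by (intro mult_right_mono) (auto simp: dist_norm)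
  also have "\<dots> = inner (x - y) (x - y)"
    by (simp add: dot_square_norm power2_eq_square)
  finally show ?thesis
    by (simp add: inner_diff_left)
qed

lemma nonexpansive_fixed_set_closed:
  fixes S :: "'a::real_inner \<Rightarrow> 'a"
  assumes "1-lipschitz_on C S" "closed C"
  shows "closed {x \<in> C. S x = x}"
proof -
  have "continuous_on C (\<lambda>x. S x - x)"
    using assms(1) by (intro continuous_intros lipschitz_on_continuous_on)
  from continuous_closed_preimage_constant[OF this assms(2), of 0] show ?thesis
    by simp
qed

text \<open>For \<open>z\<close> on the segment from \<open>x\<close> to \<open>y\<close>, the point
  \<open>S z\<close> is no farther from either endpoint than \<open>z\<close> is. By strict
  convexity only \<open>z\<close> itself satisfies both bounds.\<close>

lemma nonexpansive_fixed_set_convex: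
  fixes S :: "'a::real_inner \<Rightarrow> 'a"
  assumes S: "1-lipschitz_on C S" and C: "convex C"
  shows "convex {x \<in> C. S x = x}"
  unfolding convex_alt
proof clarify
  fix x y and t :: real
  assume xy: "x \<in> C" "y \<in> C" "S x = x" "S y = y" and t: "0 \<le> t" "t \<le> 1"
  define z where "z = (1 - t) *\<^sub>R x + t *\<^sub>R y"
  have z: "z \<in> C"
    using C xy t by (auto simp: convex_alt z_def)
  have zx: "z - x = t *\<^sub>R (y - x)" and zy: "z - y = (1 - t) *\<^sub>R (x - y)"
    by (simp_all add: z_def algebra_simps)
  have "norm (S z - x) \<le> t * norm (x - y)"
    using lipschitz_onD[OF S z xy(1)] xy t by (simp add: dist_norm zx norm_minus_commute)
  then have 1: "(norm (S z - x))\<^sup>2 \<le> t\<^sup>2 * (norm (x - y))\<^sup>2"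
    using power_mono[of _ _ 2] by (fastforce simp: power_mult_distrib)
  have "norm (S z - y) \<le> (1 - t) * norm (x - y)"
    using lipschitz_onD[OF S z xy(2)] xy t by (simp add: dist_norm zy)
  then have 2: "(norm (S z - y))\<^sup>2 \<le> (1 - t)\<^sup>2 * (norm (x - y))\<^sup>2"
    using power_mono[of _ _ 2] by (fastforce simp: power_mult_distrib)
  have "(norm (S z - z))\<^sup>2 \<le> (1 - t) * (t\<^sup>2 * (norm (x - y))\<^sup>2)
      + t * ((1 - t)\<^sup>2 * (norm (x - y))\<^sup>2) - t * (1 - t) * (norm (x - y))\<^sup>2"
    unfolding z_def norm_diff_convex_combination_sq
    using mult_left_mono[OF 1, of "1 - t"] mult_left_mono[OF 2, of t] t by (simp add: z_def)
  also have "\<dots> = 0"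
    by algebra
  finally have "S z = z"
    by simp
  with z show "(1 - t) *\<^sub>R x + t *\<^sub>R y \<in> C
      \<and> S ((1 - t) *\<^sub>R x + t *\<^sub>R y) = (1 - t) *\<^sub>R x + t *\<^sub>R y"
    by (simp add: z_def)
qed

lemma nonexpansive_convex_combination:
  fixes S :: "'a::real_normed_vector \<Rightarrow> 'a"
  assumes "1-lipschitz_on C S" "1-lipschitz_on C S'" "0 \<le> t" "t \<le> 1"
  shows "1-lipschitz_on C (\<lambda>x. (1 - t) *\<^sub>R S x + t *\<^sub>R S' x)"
proof (rule lipschitz_on_mono[OF lipschitz_on_add])
  show "(\<bar>1 - t\<bar> * 1)-lipschitz_on C (\<lambda>x. (1 - t) *\<^sub>R S x)"
    using assms(1) by (rule lipschitz_on_cmult)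
  show "(\<bar>t\<bar> * 1)-lipschitz_on C (\<lambda>x. t *\<^sub>R S' x)"
    using assms(2) by (rule lipschitz_on_cmult)
qed (use assms(3,4) in auto)

text \<open>The fixed points $z_n$ of the contractions $x \mapsto (u + (n+1) S x)/(n+2)$ are a
  discretization of Browder's path.\<close>

lemma Browder_path:
  fixes S :: "'a::{real_inner, banach} \<Rightarrow> 'a"
  assumes S: "1-lipschitz_on C S" "S \<in> C \<rightarrow> C"
    and C: "closed C" "convex C" "bounded C" and u: "u \<in> C"
  obtains p z where "p \<in> C" "S p = p" "z \<longlonglongrightarrow> p" "\<And>n. z n \<in> C"
    "\<And>n. z n - S (z n) = (1 / real (Suc n)) *\<^sub>R (u - z n)"
proof -
  have "\<exists>z\<in>C. z - S z = (1 / real (Suc n)) *\<^sub>R (u - z)" for n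
  proof -
    \<comment> \<open>With this weight t / (1 - t) = 1 / (n + 1), so the fixed point equation of the
      contraction becomes z - S z = (u - z) / (n + 1).\<close>
    define t where "t = 1 / real (n + 2)"
    have t: "0 < t" "t < 1" by (auto simp: t_def)
    have "\<exists>!z\<in>C. (1 - t) *\<^sub>R S z + t *\<^sub>R u = z"
    proof (rule Banach_fix[where c = "1 - t"])
      show "complete C" "C \<noteq> {}" using C u by (auto simp: complete_eq_closed)
      show "(\<lambda>z. (1 - t) *\<^sub>R S z + t *\<^sub>R u) ` C \<subseteq> C"
        using S(2) u t by (auto intro!: convexD_alt[OF C(2)])
      show "dist ((1 - t) *\<^sub>R S x + t *\<^sub>R u) ((1 - t) *\<^sub>R S y + t *\<^sub>R u) \<le> (1 - t) * dist x y"
        if "x \<in> C" "y \<in> C" for x y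
        using lipschitz_onD[OF S(1) that] t
        by (simp add: dist_norm flip: scaleR_diff_right)
    qed (use t in auto)
    then obtain z where z: "z \<in> C" "(1 - t) *\<^sub>R S z + t *\<^sub>R u = z" by blast
    have "real (n + 2) *\<^sub>R z = real (Suc n) *\<^sub>R S z + u"
    proof -
      have "real (n + 2) *\<^sub>R z = (real (n + 2) * (1 - t)) *\<^sub>R S z + (real (n + 2) * t) *\<^sub>R u"
        by (subst z(2)[symmetric]) (simp only: scaleR_add_right scaleR_scaleR)
      moreover have "real (n + 2) * (1 - t) = real (Suc n)" "real (n + 2) * t = 1"
        by (simp_all add: t_def field_simps)
      ultimately show ?thesis by simp
    qed
    then have "real (Suc n) *\<^sub>R (z - S z) = u - z"
      by (simp add: algebra_simps scaleR_2)
    then have "z - S z = (1 / real (Suc n)) *\<^sub>R (u - z)"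
      by (metis (no_types) divide_inverse mult_1 of_nat_eq_0_iff old.nat.distinct(2)
          scaleR_one scaleR_scaleR left_inverse)
    with z(1) show ?thesis by blast
  qed
  then obtain z where z: "\<And>n. z n \<in> C"
      and zS: "\<And>n. z n - S (z n) = (1 / real (Suc n)) *\<^sub>R (u - z n)"
    by metis
  \<comment> \<open>Distances from \<open>u\<close> grow along the path, and the growth of their
    squares controls the gaps. A bounded monotone real sequence therefore makes \<open>z\<close>
    Cauchy in norm.\<close>
  have key: "(norm (z m - z n))\<^sup>2 \<le> (norm (z n - u))\<^sup>2 - (norm (z m - u))\<^sup>2" if "m \<le> n" for m n
  proof (cases "m = n")
    case False
    define a where "a = 1 / real (Suc m)"
    define b where "b = 1 / real (Suc n)"
    have ab: "0 < b" "b < a"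
      using that False by (auto simp: a_def b_def field_simps)
    define v where "v = z m - u"
    define w where "w = z n - u"
    have vw: "z m - z n = v - w" by (simp add: v_def w_def)
    have "0 \<le> inner (b *\<^sub>R w - a *\<^sub>R v) (v - w)"
      using nonexpansive_complement_monotone[OF S(1) z z, of m n] unfolding zS vw
      by (simp add: a_def b_def v_def w_def algebra_simps)
    moreover have "2 * inner (b *\<^sub>R w - a *\<^sub>R v) (v - w)
        = (a - b) * ((norm w)\<^sup>2 - (norm v)\<^sup>2) - (a + b) * (norm (v - w))\<^sup>2"
      unfolding power2_norm_eq_inner
      by (simp add: inner_diff_left inner_diff_right inner_commute algebra_simps)
    ultimately have *: "(a + b) * (norm (v - w))\<^sup>2 \<le> (a - b) * ((norm w)\<^sup>2 - (norm v)\<^sup>2)"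
      by simp
    \<comment> \<open>The sign of the difference of squares must be known before
      \<open>a - b\<close> may be enlarged to \<open>a + b\<close>, which then cancels.\<close>
    have "0 \<le> (a + b) * (norm (v - w))\<^sup>2" using ab by simp
    with * have "0 \<le> (a - b) * ((norm w)\<^sup>2 - (norm v)\<^sup>2)" by linarith
    then have "0 \<le> (norm w)\<^sup>2 - (norm v)\<^sup>2"
      using ab by (simp add: zero_le_mult_iff)
    then have "(a - b) * ((norm w)\<^sup>2 - (norm v)\<^sup>2) \<le> (a + b) * ((norm w)\<^sup>2 - (norm v)\<^sup>2)"
      using ab by (intro mult_right_mono) auto
    with * have "(a + b) * (norm (v - w))\<^sup>2 \<le> (a + b) * ((norm w)\<^sup>2 - (norm v)\<^sup>2)" by linarith
    then have "(norm (v - w))\<^sup>2 \<le> (norm w)\<^sup>2 - (norm v)\<^sup>2"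
      by (rule mult_left_le_imp_le) (use ab in auto)
    then show ?thesis
      by (simp only: vw v_def w_def)
  qed simp
  define r where "r n = (norm (z n - u))\<^sup>2" for n
  obtain D where D: "\<And>x y. x \<in> C \<Longrightarrow> y \<in> C \<Longrightarrow> dist x y \<le> D"
    using C(3) by (metis bounded_two_points)
  have r_le: "r n \<le> D\<^sup>2" for n
    unfolding r_def using D[OF z u] by (intro power_mono) (auto simp: dist_norm)
  have "incseq r"
    using key by (intro monoI) (smt (verit) r_def zero_le_power2)
  then have "convergent r"
    using r_le by (metis convergentI incseq_convergent)
  then have "Cauchy r"
    by (rule convergent_Cauchy)
  have "Cauchy z"
  proof (rule metric_CauchyI)
    fix e :: real assume "0 < e"
    then obtain M where M: "\<And>m n. m \<ge> M \<Longrightarrow> n \<ge> M \<Longrightarrow> dist (r m) (r n) < e\<^sup>2"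
      using \<open>Cauchy r\<close> by (metis metric_CauchyD zero_less_power)
    have "dist (z m) (z n) < e" if "m \<ge> M" "m \<le> n" for m n
    proof -
      have "(dist (z m) (z n))\<^sup>2 < e\<^sup>2"
        using key[OF that(2)] M[of m n] that by (simp add: dist_norm r_def)
      then show ?thesis
        using \<open>0 < e\<close> by (simp add: power2_less_imp_less)
    qed
    then show "\<exists>M. \<forall>m\<ge>M. \<forall>n\<ge>M. dist (z m) (z n) < e"
      by (metis dist_commute nat_le_linear)
  qed
  then obtain p where p: "z \<longlonglongrightarrow> p"
    by (auto simp: Cauchy_convergent_iff convergent_def)
  have "p \<in> C"
    using closed_sequentially[OF C(1) _ p] z by blast
  have "(\<lambda>n. (1 / real (Suc n)) *\<^sub>R (u - z n)) \<longlonglongrightarrow> 0 *\<^sub>R (u - p)"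
    by (intro tendsto_intros p LIMSEQ_Suc[OF lim_1_over_n])
  then have "(\<lambda>n. z n - S (z n)) \<longlonglongrightarrow> 0"
    by (simp add: zS)
  moreover have "(\<lambda>n. z n - S (z n)) \<longlonglongrightarrow> p - S p"
    using continuous_on_tendsto_compose[OF lipschitz_on_continuous_on[OF S(1)] p \<open>p \<in> C\<close>] z
    by (intro tendsto_diff p) auto
  ultimately have "p - S p = 0"
    by (metis LIMSEQ_unique)
  with that[OF \<open>p \<in> C\<close> _ p z zS] show ?thesis by simp
qed

text \<open>Commutation makes the fixed point set of \<open>S\<close> invariant under
  \<open>T\<close>. This set is nonempty, closed, convex and bounded, so \<open>T\<close> has a
  fixed point inside it.\<close>

lemma commuting_nonexpansive_common_fixed_point:
  fixes S T :: "'a::{real_inner, banach} \<Rightarrow> 'a"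
  assumes S: "1-lipschitz_on C S" "S \<in> C \<rightarrow> C" and T: "1-lipschitz_on C T" "T \<in> C \<rightarrow> C"
    and comm: "\<And>x. x \<in> C \<Longrightarrow> S (T x) = T (S x)"
    and C: "closed C" "convex C" "bounded C" "C \<noteq> {}"
  obtains w where "w \<in> C" "S w = w" "T w = w"
proof -
  define F where "F = {x \<in> C. S x = x}"
  obtain u where "u \<in> C" using C(4) by blast
  then obtain p where p: "p \<in> F"
    using Browder_path[OF S C(1-3)] unfolding F_def by blast
  have F: "closed F" "convex F" "bounded F" "1-lipschitz_on F T" "T \<in> F \<rightarrow> F"
    using nonexpansive_fixed_set_closed[OF S(1) C(1)] nonexpansive_fixed_set_convex[OF S(1) C(2)]
      C(3) lipschitz_on_subset[OF T(1)] T(2) comm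
    by (auto simp: F_def intro: bounded_subset)
  obtain w where "w \<in> F" "T w = w"
    by (rule Browder_path[OF F(4,5,1,2,3) p])
  then show ?thesis
    by (intro that[of w]) (auto simp: F_def)
qed

text \<open>\<open>z\<close> is the midpoint of \<open>S z\<close> and \<open>T z\<close>, neither
  of which is farther from \<open>w\<close> than \<open>z\<close> is. Strict convexity makes them
  coincide. The point \<open>w\<close> is essential: the shifts by 1 and -1 on the line average to
  the identity.\<close>

lemma average_fixed_pointD:
  fixes S T :: "'a::real_inner \<Rightarrow> 'a"
  assumes S: "1-lipschitz_on C S" and T: "1-lipschitz_on C T"
    and w: "w \<in> C" "S w = w" "T w = w"
    and z: "z \<in> C" "(1/2) *\<^sub>R S z + (1/2) *\<^sub>R T z = z"
  shows "S z = z \<and> T z = z"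
proof -
  have "(norm (w - S z))\<^sup>2 \<le> (norm (w - z))\<^sup>2" "(norm (w - T z))\<^sup>2 \<le> (norm (w - z))\<^sup>2"
    using lipschitz_onD[OF S w(1) z(1)] lipschitz_onD[OF T w(1) z(1)] w
    by (auto simp: dist_norm intro!: power_mono)
  moreover have "(norm (w - z))\<^sup>2
      = (norm (w - S z))\<^sup>2 / 2 + (norm (w - T z))\<^sup>2 / 2 - (norm (S z - T z))\<^sup>2 / 4"
    using norm_diff_convex_combination_sq[of w "1/2" "S z" "T z"] z(2) by simp
  ultimately have "(norm (S z - T z))\<^sup>2 \<le> 0" by linarith
  then have "S z = T z" by simp
  moreover from this have "(1/2) *\<^sub>R S z + (1/2) *\<^sub>R T z = S z"
    by (simp flip: scaleR_add_left)
  ultimately show ?thesis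
    using z(2) by simp
qed

section \<open>Halpern iteration\<close>

text \<open>When the recurrence is unrolled, the initial value is damped by a product of factors 1 -
  l, which is at most exp of minus the sum of the \<open>l n\<close>. The errors \<open>b\<close>
  enter only through convex combinations, and the errors \<open>c\<close> contribute at most a tail
  of their series.\<close>

lemma tendsto_zero_contractive_recurrence:
  fixes s b c l :: "nat \<Rightarrow> real"
  assumes s: "\<And>n. 0 \<le> s n" and l: "\<And>n. 0 \<le> l n" "\<And>n. l n \<le> 1"
    and rec: "\<And>n. s (Suc n) \<le> (1 - l n) * s n + l n * b n + c n"
    and b: "\<And>e. 0 < e \<Longrightarrow> eventually (\<lambda>n. b n \<le> e) sequentially"
    and c: "\<And>n. 0 \<le> c n" "summable c"
    and div: "filterlim (\<lambda>N. \<Sum>n<N. l n) at_top sequentially"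
  shows "s \<longlonglongrightarrow> 0"
proof (rule order_tendstoI)
  fix e :: real assume "0 < e"
  \<comment> \<open>One third each for the \<open>b\<close> errors, the tail of \<open>c\<close> and
    the damped initial value.\<close>
  define d where "d = e / 3"
  have "0 < d" using \<open>0 < e\<close> by (simp add: d_def)
  obtain N1 where N1: "\<And>n. n \<ge> N1 \<Longrightarrow> b n \<le> d"
    using b[OF \<open>0 < d\<close>] by (auto simp: eventually_sequentially)
  obtain N2 where N2: "\<And>n. n \<ge> N2 \<Longrightarrow> norm (\<Sum>i. c (i + n)) < d"
    using suminf_exist_split[OF \<open>0 < d\<close> c(2)] by blast
  define N where "N = max N1 N2"
  have tail: "(\<Sum>i<m. c (i + N)) < d" for m
    using sum_le_suminf[OF summable_ignore_initial_segment[OF c(2), of N], of "{..<m}"] c(1)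
      N2[of N] by (simp add: N_def)
  have bound: "s (m + N) \<le> d + (\<Sum>i<m. c (i + N)) + exp (- (\<Sum>i<m. l (i + N))) * s N" for m
  proof (induction m)
    case (Suc m)
    define X where "X = (\<Sum>i<m. c (i + N))"
    define Y where "Y = exp (- (\<Sum>i<m. l (i + N))) * s N"
    define k where "k = l (m + N)"
    have k: "0 \<le> k" "k \<le> 1" using l by (auto simp: k_def)
    have XY: "0 \<le> X" "0 \<le> Y" using c(1) s by (auto simp: X_def Y_def intro: sum_nonneg)
    have "s (Suc m + N) \<le> (1 - k) * s (m + N) + k * b (m + N) + c (m + N)"
      using rec[of "m + N"] by (simp add: k_def)
    also have "\<dots> \<le> (1 - k) * (d + X + Y) + k * d + c (m + N)"
      using Suc k N1[of "m + N"] unfolding X_def Y_def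
      by (intro add_mono mult_left_mono) (auto simp: N_def)
    also have "\<dots> = d + (X - k * X) + c (m + N) + (1 - k) * Y"
      by (simp add: algebra_simps)
    \<comment> \<open>The nonnegative term \<open>k * X\<close> is dropped, and 1 - k is bounded by
      exp (-k).\<close>
    also have "\<dots> \<le> d + X + c (m + N) + exp (- k) * Y"
      using XY k exp_ge_add_one_self[of "- k"] by (intro add_mono mult_right_mono) auto
    also have "exp (- k) * Y = exp (- (\<Sum>i<Suc m. l (i + N))) * s N"
      by (simp add: Y_def k_def exp_add[symmetric] flip: mult.assoc)
    finally show ?case by (simp add: X_def add.assoc)
  qed (use s \<open>0 < d\<close> in simp)
  have "filterlim (\<lambda>m. - (\<Sum>n<N. l n) + (\<Sum>n<m + N. l n)) at_top sequentially"
    by (rule filterlim_tendsto_add_at_top[OF tendsto_const])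
      (rule filterlim_compose[OF div filterlim_add_const_nat_at_top])
  moreover have "- (\<Sum>n<N. l n) + (\<Sum>n<m + N. l n) = (\<Sum>i<m. l (i + N))" for m
    by (induction m) auto
  ultimately have "filterlim (\<lambda>m. \<Sum>i<m. l (i + N)) at_top sequentially"
    by simp
  then have "(\<lambda>m. exp (- (\<Sum>i<m. l (i + N))) * s N) \<longlonglongrightarrow> 0"
    by (intro tendsto_mult_left_zero filterlim_compose[OF exp_at_bot])
      (simp add: filterlim_uminus_at_top)
  then have "eventually (\<lambda>m. exp (- (\<Sum>i<m. l (i + N))) * s N < d) sequentially"
    using \<open>0 < d\<close> by (rule order_tendstoD(2))
  then have "eventually (\<lambda>m. s (m + N) < e) sequentially"
  proof eventually_elim
    case (elim m)
    then show ?case using bound[of m] tail[of m] by (simp add: d_def)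
  qed
  then show "eventually (\<lambda>n. s n < e) sequentially"
    by (rule iffD1[OF eventually_sequentially_seg])
next
  fix a :: real assume "a < 0"
  then show "eventually (\<lambda>n. a < s n) sequentially"
    using s by (intro always_eventually) (meson less_le_trans)
qed

text \<open>Wittmann's theorem. Monotonicity of $I - S$ compares the iterates with the Browder path,
  which replaces the usual weak compactness argument.\<close>

theorem Halpern_iteration_converges:
  fixes S :: "'a::{real_inner, banach} \<Rightarrow> 'a"
  assumes S: "1-lipschitz_on C S" "S \<in> C \<rightarrow> C"
    and C: "closed C" "convex C" "bounded C" and u: "u \<in> C"
    and y0: "y 0 \<in> C" and rec: "\<And>n. y (Suc n) = (1 - l n) *\<^sub>R S (y n) + l n *\<^sub>R u"
    and l: "\<And>n. 0 \<le> l n" "\<And>n. l n \<le> 1" "l \<longlonglongrightarrow> 0"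
    and div: "filterlim (\<lambda>N. \<Sum>n<N. l n) at_top sequentially"
    and var: "summable (\<lambda>n. \<bar>l (Suc n) - l n\<bar>)"
  obtains p where "p \<in> C" "S p = p" "y \<longlonglongrightarrow> p"
proof -
  obtain p z where p: "p \<in> C" "S p = p" and zp: "z \<longlonglongrightarrow> p" and z: "\<And>n. z n \<in> C"
    and zS: "\<And>n. z n - S (z n) = (1 / real (Suc n)) *\<^sub>R (u - z n)"
    using Browder_path[OF S C u] by metis
  obtain D where D: "\<And>x y. x \<in> C \<Longrightarrow> y \<in> C \<Longrightarrow> dist x y \<le> D"
    using C(3) by (metis bounded_two_points)
  have Dn: "norm (x - y) \<le> D" if "x \<in> C" "y \<in> C" for x y
    using D[OF that] by (simp add: dist_norm)
  have "0 \<le> D" using D[OF u u] by simp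
  have y: "y n \<in> C" for n
    by (induction n) (use y0 rec S(2) u l in \<open>auto intro!: convexD_alt[OF C(2)]\<close>)
  have Sy: "S (y n) \<in> C" for n
    using y S(2) by blast

  \<comment> \<open>Consecutive steps contract up to the change of the weights, so the recurrence
    lemma applies with \<open>b\<close> zero and \<open>c\<close> the summable variation of
    \<open>l\<close> times \<open>D\<close>.\<close>
  have step: "(\<lambda>n. norm (y (Suc n) - y n)) \<longlonglongrightarrow> 0"
  proof (rule tendsto_zero_contractive_recurrence)
    fix n
    have eq: "y (Suc (Suc n)) - y (Suc n)
        = (1 - l (Suc n)) *\<^sub>R (S (y (Suc n)) - S (y n)) + (l (Suc n) - l n) *\<^sub>R (u - S (y n))"
      unfolding rec[of "Suc n"] rec[of n] by (simp add: algebra_simps)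
    have "norm (y (Suc (Suc n)) - y (Suc n))
        \<le> norm ((1 - l (Suc n)) *\<^sub>R (S (y (Suc n)) - S (y n)))
          + norm ((l (Suc n) - l n) *\<^sub>R (u - S (y n)))"
      unfolding eq by (rule norm_triangle_ineq)
    also have "\<dots> = (1 - l (Suc n)) * norm (S (y (Suc n)) - S (y n))
        + \<bar>l (Suc n) - l n\<bar> * norm (u - S (y n))"
      using l by simp
    also have "\<dots> \<le> (1 - l (Suc n)) * norm (y (Suc n) - y n) + \<bar>l (Suc n) - l n\<bar> * D"
      using lipschitz_onD[OF S(1) y y, of "Suc n" n] l Dn[OF u Sy[of n]]
      by (intro add_mono mult_left_mono) (auto simp: dist_norm)
    finally show "norm (y (Suc (Suc n)) - y (Suc n)) \<le> (1 - l (Suc n)) * norm (y (Suc n) - y n)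
        + l (Suc n) * 0 + \<bar>l (Suc n) - l n\<bar> * D"
      by simp
  next
    \<comment> \<open>The contraction weight here is \<open>l (Suc n)\<close>; the shift changes the
      partial sums only by the constant \<open>l 0\<close>.\<close>
    have "filterlim (\<lambda>N. - l 0 + (\<Sum>n<Suc N. l n)) at_top sequentially"
      by (rule filterlim_tendsto_add_at_top[OF tendsto_const])
        (rule filterlim_compose[OF div filterlim_Suc])
    then show "filterlim (\<lambda>N. \<Sum>n<N. l (Suc n)) at_top sequentially"
      by (simp only: sum.lessThan_Suc_shift) simp
  qed (use l \<open>0 \<le> D\<close> summable_mult2[OF var, of D] in auto)

  define \<delta> where "\<delta> n = norm (y n - S (y n))" for n
  \<comment> \<open>\<open>y (Suc n)\<close> lies within \<open>l n * D\<close> of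
    \<open>S (y n)\<close>, so small steps make the iterates approximate fixed points.\<close>
  have "\<delta> \<longlonglongrightarrow> 0"
  proof (rule tendsto_sandwich[where f = "\<lambda>_. 0"])
    show "eventually (\<lambda>n. \<delta> n \<le> norm (y (Suc n) - y n) + l n * D) sequentially"
    proof (intro always_eventually allI)
      fix n
      have "y n - S (y n) = (y n - y (Suc n)) + l n *\<^sub>R (u - S (y n))"
        by (simp add: rec[of n] algebra_simps)
      then have "\<delta> n \<le> norm (y n - y (Suc n)) + norm (l n *\<^sub>R (u - S (y n)))"
        unfolding \<delta>_def by (metis norm_triangle_ineq)
      also have "norm (l n *\<^sub>R (u - S (y n))) \<le> l n * D"
        using l Dn[OF u Sy[of n]] by (simp add: mult_left_mono)
      finally show "\<delta> n \<le> norm (y (Suc n) - y n) + l n * D"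
        by (simp add: norm_minus_commute)
    qed
    show "(\<lambda>n. norm (y (Suc n) - y n) + l n * D) \<longlonglongrightarrow> 0"
      using tendsto_add[OF step tendsto_mult_right[OF l(3), of D]] by simp
  qed (auto simp: \<delta>_def)

  \<comment> \<open>An asymptotic variational inequality at \<open>p\<close>. It is first proved
    with \<open>z n\<close> in place of \<open>p\<close>, for fixed \<open>n\<close> as
    \<open>k\<close> grows; the factor \<open>real (Suc n)\<close> is harmless because
    \<open>n\<close> is chosen before \<open>k\<close>.\<close>
  have limsup: "eventually (\<lambda>k. inner (u - p) (y k - p) \<le> e) sequentially" if "0 < e" for e
  proof -
    have path: "inner (u - z n) (y k - z n) \<le> real (Suc n) * (\<delta> k * D)" for n k
    proof -
      have "0 \<le> inner ((z n - S (z n)) - (y k - S (y k))) (z n - y k)"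
        by (rule nonexpansive_complement_monotone[OF S(1) z y])
      then have "inner (z n - S (z n)) (y k - z n) \<le> inner (y k - S (y k)) (y k - z n)"
        by (simp add: inner_diff_left inner_diff_right)
      also have "\<dots> \<le> norm (y k - S (y k)) * norm (y k - z n)"
        by (rule norm_cauchy_schwarz)
      also have "\<dots> \<le> \<delta> k * D"
        unfolding \<delta>_def using Dn[OF y z] by (intro mult_left_mono) auto
      finally have "inner (u - z n) (y k - z n) / real (Suc n) \<le> \<delta> k * D"
        by (simp add: zS)
      then show ?thesis
        by (simp add: field_simps)
    qed
    have "(\<lambda>n. 2 * D * norm (z n - p)) \<longlonglongrightarrow> 0"
      using tendsto_mult_right_zero[OF tendsto_norm_zero[OF LIM_zero[OF zp]]] by simp
    \<comment> \<open>Replacing \<open>z n\<close> by \<open>p\<close> in the inner product produces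
      two corrections, each at most \<open>D * norm (z n - p)\<close>.\<close>
    then obtain n where n: "2 * D * norm (z n - p) < e / 2"
      using order_tendstoD(2)[of _ 0 sequentially "e / 2"] \<open>0 < e\<close>
      by (fastforce simp: eventually_sequentially)
    have "(\<lambda>k. real (Suc n) * (\<delta> k * D)) \<longlonglongrightarrow> 0"
      using tendsto_mult_right_zero[OF tendsto_mult_left_zero[OF \<open>\<delta> \<longlonglongrightarrow> 0\<close>]] .
    then have "eventually (\<lambda>k. real (Suc n) * (\<delta> k * D) < e / 2) sequentially"
      using half_gt_zero[OF \<open>0 < e\<close>] by (rule order_tendstoD(2))
    then show ?thesis
    proof eventually_elim
      case (elim k)
      have "inner (u - p) (y k - p) = inner (u - z n) (y k - z n)
          + inner (z n - p) (y k - z n) + inner (u - p) (z n - p)"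
        by (simp add: inner_diff_left inner_diff_right)
      moreover have "inner (z n - p) (y k - z n) \<le> norm (z n - p) * D"
        by (rule order_trans[OF norm_cauchy_schwarz]) (intro mult_left_mono Dn y z norm_ge_zero)
      moreover have "inner (u - p) (z n - p) \<le> D * norm (z n - p)"
        by (rule order_trans[OF norm_cauchy_schwarz]) (intro mult_right_mono Dn u p norm_ge_zero)
      ultimately show ?case
        using path[of n k] n elim by (simp add: mult.commute)
    qed
  qed

  \<comment> \<open>The second use of the recurrence lemma: now \<open>c\<close> is zero and
    \<open>b\<close> is twice the inner product bounded in \<open>limsup\<close>, at index
    \<open>Suc n\<close>.\<close>
  have "(\<lambda>n. (norm (y n - p))\<^sup>2) \<longlonglongrightarrow> 0"
  proof (rule tendsto_zero_contractive_recurrence)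
    fix n
    have "y (Suc n) - p = (1 - l n) *\<^sub>R (S (y n) - p) + l n *\<^sub>R (u - p)"
      by (simp add: rec algebra_simps)
    then have "(norm (y (Suc n) - p))\<^sup>2
        \<le> (norm ((1 - l n) *\<^sub>R (S (y n) - p)))\<^sup>2 + 2 * inner (l n *\<^sub>R (u - p)) (y (Suc n) - p)"
      by (metis norm_add_sq_le)
    also have "(norm ((1 - l n) *\<^sub>R (S (y n) - p)))\<^sup>2 = (1 - l n)\<^sup>2 * (norm (S (y n) - p))\<^sup>2"
      by (simp add: power_mult_distrib)
    also have "\<dots> \<le> (1 - l n) * (norm (y n - p))\<^sup>2"
    proof (rule mult_mono)
      show "(1 - l n)\<^sup>2 \<le> 1 - l n"
        using l mult_left_le[of "1 - l n" "1 - l n"] by (simp add: power2_eq_square)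
      show "(norm (S (y n) - p))\<^sup>2 \<le> (norm (y n - p))\<^sup>2"
        using lipschitz_onD[OF S(1) y p(1), of n] p(2)
        by (intro power_mono) (auto simp: dist_norm)
    qed (use l in auto)
    finally show "(norm (y (Suc n) - p))\<^sup>2 \<le> (1 - l n) * (norm (y n - p))\<^sup>2
        + l n * (2 * inner (u - p) (y (Suc n) - p)) + 0"
      by (simp add: algebra_simps)
  next
    fix e :: real assume "0 < e"
    then have "eventually (\<lambda>n. inner (u - p) (y (Suc n) - p) \<le> e / 2) sequentially"
      using limsup[of "e / 2"] by (intro iffD2[OF eventually_sequentially_Suc]) simp
    then show "eventually (\<lambda>n. 2 * inner (u - p) (y (Suc n) - p) \<le> e) sequentially"
      by eventually_elim simp
  qed (use l div in auto)
  then have "(\<lambda>n. norm (y n - p)) \<longlonglongrightarrow> 0"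
    using tendsto_real_sqrt[of "\<lambda>n. (norm (y n - p))\<^sup>2" 0] by simp
  then have "y \<longlonglongrightarrow> p"
    by (simp add: LIM_zero_iff tendsto_norm_zero_iff)
  with that p show ?thesis by blast
qed

section \<open>Common fixed points of a semigroup\<close>

text \<open>The times fixing $z$, taken up to sign, form an additive subgroup of the reals, which is
  dense as soon as it contains two incommensurable elements. The hypothesis does not make $T(0)$
  the identity, so $T(0) z = z$ is itself derived from $T(\alpha) z = z$.\<close>

lemma semigroup_common_fixed_point:
  assumes sg: "nonexpansive_semigroup \<tau> C T" and \<tau>: "Hausdorff_space \<tau>"
    and ab: "0 < \<alpha>" "0 < \<beta>" "\<alpha> / \<beta> \<notin> \<rat>"
    and z: "z \<in> C" "T \<alpha> z = z" "T \<beta> z = z"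
  shows "common_fixed_point C T z"
proof -
  have sum: "T (s + t) z = T s (T t z)" if "0 \<le> s" "0 \<le> t" for s t
    using sg z that by (simp add: nonexpansive_semigroup_def)
  define G where "G = {t. T \<bar>t\<bar> z = z}"
  \<comment> \<open>Since \<open>z\<close> equals \<open>T t z\<close>, applying
    \<open>T (s - t)\<close> gives \<open>T s z\<close>, so times can be subtracted without
    inverting any map. The case \<open>s = t\<close> covers time 0.\<close>
  have sub: "T (s - t) z = z" if "T s z = z" "T t z = z" "0 \<le> t" "t \<le> s" for s t
    using sum[of "s - t" t] that by simp
  have minus: "- t \<in> G" if "t \<in> G" for t
    using that by (simp add: G_def)
  have add: "s + t \<in> G" if "s \<in> G" "t \<in> G" for s t
  proof -
    consider "\<bar>s + t\<bar> = \<bar>s\<bar> + \<bar>t\<bar>" | "\<bar>s + t\<bar> = \<bar>s\<bar> - \<bar>t\<bar>" "\<bar>t\<bar> \<le> \<bar>s\<bar>"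
      | "\<bar>s + t\<bar> = \<bar>t\<bar> - \<bar>s\<bar>" "\<bar>s\<bar> \<le> \<bar>t\<bar>" by linarith
    then show ?thesis
      using that sum[of "\<bar>s\<bar>" "\<bar>t\<bar>"] sub[of "\<bar>s\<bar>" "\<bar>t\<bar>"] sub[of "\<bar>t\<bar>" "\<bar>s\<bar>"]
      by cases (auto simp: G_def)
  qed
  have nat: "real n * t \<in> G" if "t \<in> G" for n t
  proof (induction n)
    case 0
    show ?case using add[OF that minus[OF that]] by simp
  next
    case (Suc n)
    show ?case using add[OF that Suc] by (simp add: algebra_simps)
  qed
  have int: "of_int k * t \<in> G" if "t \<in> G" for k t
    using nat[OF that] minus[OF nat[OF that]] by (cases k rule: int_cases2) auto
  have "\<alpha> \<in> G" "\<beta> \<in> G"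
    using ab z by (auto simp: G_def)
  have dense: "\<exists>s\<in>{t. 0 \<le> t \<and> T t z = z}. dist s t < e" if "0 \<le> t" "0 < e" for t e
  proof -
    \<comment> \<open>Integer multiples of an irrational number are dense modulo 1; dividing by
      \<open>\<beta>\<close> turns approximation of \<open>t\<close> by integer combinations of
      \<open>\<alpha>\<close> and \<open>\<beta>\<close> into this fact.\<close>
    obtain h k :: int where hk: "\<bar>of_int k * (\<alpha> / \<beta>) - of_int h - t / \<beta>\<bar> < e / \<beta>"
      using sequence_of_fractional_parts_is_dense[OF ab(3), of "e / \<beta>" "t / \<beta>"] ab \<open>0 < e\<close>
      by (metis divide_pos_pos)
    define s where "s = of_int k * \<alpha> + of_int (- h) * \<beta>"
    have "s \<in> G"
      unfolding s_def by (intro add int \<open>\<alpha> \<in> G\<close> \<open>\<beta> \<in> G\<close>)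
    have "of_int k * (\<alpha> / \<beta>) - of_int h - t / \<beta> = (s - t) / \<beta>"
      using ab by (simp add: s_def field_simps)
    with hk have "\<bar>s - t\<bar> < e"
      using ab by (simp add: abs_divide divide_less_cancel)
    \<comment> \<open>\<open>s\<close> may be negative, but its absolute value is at least as close
      to the nonnegative \<open>t\<close> and is a genuine fixing time.\<close>
    then have "dist \<bar>s\<bar> t < e"
      using \<open>0 \<le> t\<close> by (simp add: dist_real_def)
    with \<open>s \<in> G\<close> show ?thesis
      by (intro bexI[of _ "\<bar>s\<bar>"]) (auto simp: G_def)
  qed
  \<comment> \<open>The orbit map and the constant map \<open>z\<close> are continuous into a
    Hausdorff space and agree on a dense set of times, hence everywhere.\<close>
  have "T t z = z" if "0 \<le> t" for t
  proof (rule forall_in_closure_of_eq[where f = "\<lambda>t. T t z" and g = "\<lambda>_. z"])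
    show "t \<in> top_of_set {0..} closure_of {t. 0 \<le> t \<and> T t z = z}"
      using dense[OF that] that
      by (auto simp: closure_of_subtopology closure_approachable Int_absorb1 subset_iff)
    show "Hausdorff_space (subtopology \<tau> C)"
      using \<tau> by (rule Hausdorff_space_subtopology)
    show cont: "continuous_map (top_of_set {0..}) (subtopology \<tau> C) (\<lambda>t. T t z)"
      using sg z by (simp add: nonexpansive_semigroup_def)
    have "T \<alpha> z \<in> topspace (subtopology \<tau> C)"
      using continuous_map_image_subset_topspace[OF cont] ab(1) by (auto simp: image_subset_iff)
    then have "z \<in> topspace (subtopology \<tau> C)"
      by (simp only: z(2))
    then show "continuous_map (top_of_set {0..}) (subtopology \<tau> C) (\<lambda>t. z)"
      by simp
  qed auto
  with z(1) show ?thesis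
    by (simp add: common_fixed_point_def)
qed

theorem theorem11:
  fixes \<tau> :: "'a::{real_inner, banach} topology"
    and C :: "'a set"
    and T :: "real \<Rightarrow> 'a \<Rightarrow> 'a"
    and \<alpha> \<beta> :: real
    and u :: 'a
    and x :: "nat \<Rightarrow> 'a"
    and l :: "nat \<Rightarrow> real"
  assumes "topspace \<tau> = UNIV" and "Hausdorff_space \<tau>"
    and "bounded C" and "closed C" and "convex C"
    and "nonexpansive_semigroup \<tau> C T"
    and "\<alpha> > 0" and "\<beta> > 0" and "\<alpha> / \<beta> \<notin> \<rat>"
    and "u \<in> C"
    and "x 1 \<in> C"
    and "\<And>n. n \<ge> 1 \<Longrightarrow>
           x (n + 1) = ((1 - l n) / 2) *\<^sub>R T \<alpha> (x n) + ((1 - l n) / 2) *\<^sub>R T \<beta> (x n) + l n *\<^sub>R u"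
    and "\<And>n. n \<ge> 1 \<Longrightarrow> l n \<in> {0..1}"
    and "l \<longlonglongrightarrow> 0"
    and "filterlim (\<lambda>N. \<Sum>n=1..N. l n) at_top sequentially"
    and "summable (\<lambda>n. \<bar>l (n + 2) - l (n + 1)\<bar>)"
  shows "\<exists>z. common_fixed_point C T z \<and> x \<longlonglongrightarrow> z"
proof -
  note sg = assms(6)
  have lip: "1-lipschitz_on C (T t)" and maps: "T t \<in> C \<rightarrow> C" if "0 \<le> t" for t
    using sg that by (auto simp: nonexpansive_semigroup_def lipschitz_on_def dist_norm)
  have comm: "T \<alpha> (T \<beta> y) = T \<beta> (T \<alpha> y)" if "y \<in> C" for y
    using sg that assms(7,8) unfolding nonexpansive_semigroup_def
    by (metis add.commute less_le)
  have \<alpha>: "1-lipschitz_on C (T \<alpha>)" "T \<alpha> \<in> C \<rightarrow> C" and \<beta>: "1-lipschitz_on C (T \<beta>)" "T \<beta> \<in> C \<rightarrow> C"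
    using lip maps assms(7,8) by auto
  obtain w where w: "w \<in> C" "T \<alpha> w = w" "T \<beta> w = w"
    using commuting_nonexpansive_common_fixed_point[OF \<alpha> \<beta> comm assms(4,5,3)] assms(10) by blast
  define S where "S y = (1/2) *\<^sub>R T \<alpha> y + (1/2) *\<^sub>R T \<beta> y" for y
  have S: "1-lipschitz_on C S" "S \<in> C \<rightarrow> C"
    using nonexpansive_convex_combination[OF \<alpha>(1) \<beta>(1), of "1/2"] \<alpha>(2) \<beta>(2)
    by (auto simp: S_def[abs_def] intro!: convexD[OF assms(5)])
  \<comment> \<open>The given sequences start at index 1 and the iteration theorem at 0, so both are
    shifted; the values \<open>x 0\<close> and \<open>l 0\<close> are arbitrary.\<close>
  obtain p where p: "p \<in> C" "S p = p" "(\<lambda>n. x (Suc n)) \<longlonglongrightarrow> p"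
  proof (rule Halpern_iteration_converges[OF S assms(4,5,3,10), where y = "\<lambda>n. x (Suc n)"
        and l = "\<lambda>n. l (Suc n)"])
    show "x (Suc (Suc n)) = (1 - l (Suc n)) *\<^sub>R S (x (Suc n)) + l (Suc n) *\<^sub>R u" for n
      using assms(12)[of "Suc n"] by (simp add: S_def scaleR_add_right)
    show "filterlim (\<lambda>N. \<Sum>n<N. l (Suc n)) at_top sequentially"
      using assms(15) by (simp add: sum.atLeast1_atMost_eq)
  qed (use assms(11,13,16) LIMSEQ_Suc[OF assms(14)] in auto)
  have "T \<alpha> p = p" "T \<beta> p = p"
    using average_fixed_pointD[OF \<alpha>(1) \<beta>(1) w p(1)] p(2) by (auto simp: S_def)
  then have "common_fixed_point C T p"
    using semigroup_common_fixed_point[OF sg assms(2,7,8,9) p(1)] by blast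
  moreover have "x \<longlonglongrightarrow> p"
    using p(3) by (simp add: filterlim_sequentially_Suc)
  ultimately show ?thesis by blast
qed

end
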